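(* Let $p$ be an odd prime and let $G$ be the non-abelian group of order $p^3$ with generators $a,b,c$ and relations $$a^p=b^p=c^p=1,\quad ab=bac,\quad ca=ac,\quad cb=bc.$$ Let $\alpha=a$, $\beta=b$, $\gamma=b^{-1}a^{-1}$. Then $\alpha\beta\gamma=1$; the subgroups $\langle\alpha\rangle,\langle\beta\rangle,\langle\gamma\rangle$ pairwise intersect trivially; and $\langle\alpha,\beta,\gamma\rangle=G$. Thus for each odd prime $p$ there exists a primary, $p$-homogeneous latin bitrade of size $p^3$, given by $$\bigl(\{(g\langle\alpha\rangle,g\langle\beta\rangle,g\langle\gamma\rangle)\mid g\in G\},\ \{(g\langle\alpha\rangle,g\langle\beta\rangle,g\alpha^{-1}\langle\gamma\rangle)\mid g\in G\}\bigr).$$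
   Context: Let $A_1,A_2,A_3$ be finite, non-empty, pairwise disjoint sets (of rows, columns and symbols/entries, respectively). A partial latin square is a subset $T\subseteq A_1\times A_2\times A_3$ such that (P1) if $(a_1,a_2,a_3),(b_1,b_2,b_3)\in T$ then either at most one of $a_1=b_1$, $a_2=b_2$, $a_3=b_3$ is true or all three are true; (P2) every element of $A_1\cup A_2\cup A_3$ occurs as a coordinate of some element of $T$. A latin bitrade is a pair $(T^{\circ},T^{\star})$ of partial latin squares $T^{\circ},T^{\star}\subset A_1\times A_2\times A_3$ such that (R1) $T^{\circ}\cap T^{\star}=\emptyset$; (R2) for all $(a_1,a_2,a_3)\in T^{\circ}$ and all $r\ne s$ in $\{1,2,3\}$ there is a unique $(b_1,b_2,b_3)\in T^{\star}$ with $a_r=b_r$ and $a_s=b_s$; (R3) the same as (R2) with $T^{\circ}$ and $T^{\star}$ interchanged. Its size is $|T^{\circ}|=|T^{\star}|$. In the claim, $A_1,A_2,A_3$ are the sets of left cosets in $G$ of $\langle\alpha\rangle,\langle\beta\rangle,\langle\gamma\rangle$. A latin bitrade $(T^{\circ},T^{\star})$ is primary if whenever $(U^{\circ},U^{\star})$ is a latin bitrade (with respect to some sets of rows, columns and symbols) with $U^{\circ}\subseteq T^{\circ}$ and $U^{\star}\subseteq T^{\star}$, then $(U^{\circ},U^{\star})=(T^{\circ},T^{\star})$. It is $k$-homogeneous if each row and each column of $T^{\circ}$ contains precisely $k$ entries and each symbol occurs precisely $k$ times within $T^{\circ}$. *)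

theory Defs
  imports
    "HOL-Algebra.Algebra"
    "HOL-Computational_Algebra.Primes"
begin

section \<open>Groups given by generators and relations\<close>

text \<open>
  The letter \<open>(x, True)\<close> stands for the generator \<open>x\<close>, the letter \<open>(x, False)\<close> for its inverse.
\<close>

type_synonym 'x word = "('x \<times> bool) list"

text \<open>
  A set \<open>R\<close> of pairs of words is read as the set of relations \<open>u = v\<close> with \<open>(u, v) \<in> R\<close>.
  Two words are equivalent if the relations (and free cancellation) force them to be equal:
  \<open>word_eq R\<close> is the least congruence on words that contains \<open>R\<close> and all free cancellations.
\<close>

inductive word_eq :: "('x word \<times> 'x word) set \<Rightarrow> 'x word \<Rightarrow> 'x word \<Rightarrow> bool"
  for R where
  refl: "word_eq R u u"
| sym: "word_eq R u v \<Longrightarrow> word_eq R v u"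
| trans: "word_eq R u v \<Longrightarrow> word_eq R v w \<Longrightarrow> word_eq R u w"
| append: "word_eq R u u' \<Longrightarrow> word_eq R v v' \<Longrightarrow> word_eq R (u @ v) (u' @ v')"
| cancel: "word_eq R [(x, s), (x, \<not> s)] []"
| relation: "(u, v) \<in> R \<Longrightarrow> word_eq R u v"

definition word_class :: "('x word \<times> 'x word) set \<Rightarrow> 'x word \<Rightarrow> 'x word set" where
  "word_class R u = {v. word_eq R u v}"

definition presented_group :: "('x word \<times> 'x word) set \<Rightarrow> 'x word set monoid" where
  "presented_group R =
     \<lparr>carrier = range (word_class R),
      monoid.mult = (\<lambda>U V. \<Union>u\<in>U. \<Union>v\<in>V. word_class R (u @ v)),
      one = word_class R []\<rparr>"

lemma word_class_eq_iff: "word_class R u = word_class R v \<longleftrightarrow> word_eq R u v"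
  unfolding word_class_def set_eq_iff mem_Collect_eq
  by (metis word_eq.refl word_eq.sym word_eq.trans)

lemma presented_group_mult:
  "word_class R u \<otimes>\<^bsub>presented_group R\<^esub> word_class R v = word_class R (u @ v)"
proof -
  have "word_class R (u' @ v') = word_class R (u @ v)"
    if "u' \<in> word_class R u" "v' \<in> word_class R v" for u' v'
  proof -
    have "word_eq R u u'" "word_eq R v v'"
      using that by (simp_all add: word_class_def)
    then show ?thesis
      unfolding word_class_eq_iff by (rule word_eq.sym[OF word_eq.append])
  qed
  then have "(\<Union>u'\<in>word_class R u. \<Union>v'\<in>word_class R v. word_class R (u' @ v')) =
      (\<Union>u'\<in>word_class R u. \<Union>v'\<in>word_class R v. word_class R (u @ v))"
    by (intro SUP_cong HOL.refl)
  moreover have "u \<in> word_class R u" "v \<in> word_class R v"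
    by (simp_all add: word_class_def word_eq.refl)
  ultimately show ?thesis
    unfolding presented_group_def by (simp del: UN_simps) blast
qed

lemma word_inverse_left:
  "word_eq R (rev (map (\<lambda>(x, s). (x, \<not> s)) u) @ u) []"
proof (induction u)
  case Nil
  then show ?case by (simp add: word_eq.refl)
next
  case (Cons l u)
  obtain x s where l: "l = (x, s)" by fastforce
  let ?v = "rev (map (\<lambda>(x, s). (x, \<not> s)) u)"
  have "word_eq R ([(x, \<not> s), (x, s)] @ u) ([] @ u)"
    using word_eq.append[OF word_eq.cancel[of R x "\<not> s"] word_eq.refl[of R u]] by simp
  then have "word_eq R (?v @ ([(x, \<not> s), (x, s)] @ u)) (?v @ ([] @ u))"
    by (rule word_eq.append[OF word_eq.refl])
  moreover have "word_eq R (?v @ ([] @ u)) []"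
    using Cons.IH by simp
  ultimately have "word_eq R (?v @ ([(x, \<not> s), (x, s)] @ u)) []"
    by (rule word_eq.trans)
  then show ?case
    using l by simp
qed

lemma group_presented_group: "group (presented_group R)"
proof (rule groupI)
  show "\<exists>y\<in>carrier (presented_group R). y \<otimes>\<^bsub>presented_group R\<^esub> x = \<one>\<^bsub>presented_group R\<^esub>"
    if x: "x \<in> carrier (presented_group R)" for x
  proof -
    obtain u where u: "x = word_class R u"
      using x by (auto simp: presented_group_def)
    let ?v = "rev (map (\<lambda>(x, s). (x, \<not> s)) u)"
    have "word_class R ?v \<otimes>\<^bsub>presented_group R\<^esub> x = word_class R []"
      unfolding u presented_group_mult word_class_eq_iff by (rule word_inverse_left)
    then show ?thesis
      by (auto simp: presented_group_def)
  qed
next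
  fix x y
  assume "x \<in> carrier (presented_group R)" "y \<in> carrier (presented_group R)"
  then obtain u v where "x = word_class R u" "y = word_class R v"
    by (auto simp: presented_group_def)
  then have "x \<otimes>\<^bsub>presented_group R\<^esub> y = word_class R (u @ v)"
    by (simp add: presented_group_mult)
  then show "x \<otimes>\<^bsub>presented_group R\<^esub> y \<in> carrier (presented_group R)"
    by (simp add: presented_group_def)
next
  show "\<one>\<^bsub>presented_group R\<^esub> \<in> carrier (presented_group R)"
    by (simp add: presented_group_def)
next
  fix x y z
  assume "x \<in> carrier (presented_group R)" "y \<in> carrier (presented_group R)"
    "z \<in> carrier (presented_group R)"
  then obtain u v w where "x = word_class R u" "y = word_class R v" "z = word_class R w"
    by (auto simp: presented_group_def)
  then show "x \<otimes>\<^bsub>presented_group R\<^esub> y \<otimes>\<^bsub>presented_group R\<^esub> z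
    = x \<otimes>\<^bsub>presented_group R\<^esub> (y \<otimes>\<^bsub>presented_group R\<^esub> z)"
    by (simp add: presented_group_mult)
next
  fix x
  assume "x \<in> carrier (presented_group R)"
  then obtain u where "x = word_class R u"
    by (auto simp: presented_group_def)
  moreover have "\<one>\<^bsub>presented_group R\<^esub> = word_class R []"
    by (simp add: presented_group_def)
  ultimately show "\<one>\<^bsub>presented_group R\<^esub> \<otimes>\<^bsub>presented_group R\<^esub> x = x"
    by (simp add: presented_group_mult)
qed

datatype abc = Gen_a | Gen_b | Gen_c

text \<open>The relations \<open>a\<^sup>p = b\<^sup>p = c\<^sup>p = 1\<close>, \<open>ab = bac\<close>, \<open>ca = ac\<close>, \<open>cb = bc\<close>.\<close>

definition abc_relations :: "nat \<Rightarrow> (abc word \<times> abc word) set" where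
  "abc_relations p =
     (let a = (Gen_a, True); b = (Gen_b, True); c = (Gen_c, True)
      in {(replicate p a, []), (replicate p b, []), (replicate p c, []),
          ([a, b], [b, a, c]), ([c, a], [a, c]), ([c, b], [b, c])})"

definition abc_group :: "nat \<Rightarrow> abc word set monoid" where
  "abc_group p = presented_group (abc_relations p)"

definition abc_gen :: "nat \<Rightarrow> abc \<Rightarrow> abc word set" where
  "abc_gen p x = word_class (abc_relations p) [(x, True)]"


section \<open>Latin bitrades\<close>

fun coord :: "nat \<Rightarrow> 'a \<times> 'a \<times> 'a \<Rightarrow> 'a" where
  "coord r (x\<^sub>1, x\<^sub>2, x\<^sub>3) = (if r = 1 then x\<^sub>1 else if r = 2 then x\<^sub>2 else x\<^sub>3)"

definition partial_latin_square ::
  "'a set \<Rightarrow> 'a set \<Rightarrow> 'a set \<Rightarrow> ('a \<times> 'a \<times> 'a) set \<Rightarrow> bool" where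
  "partial_latin_square A\<^sub>1 A\<^sub>2 A\<^sub>3 T \<longleftrightarrow>
     finite A\<^sub>1 \<and> finite A\<^sub>2 \<and> finite A\<^sub>3 \<and>
     A\<^sub>1 \<noteq> {} \<and> A\<^sub>2 \<noteq> {} \<and> A\<^sub>3 \<noteq> {} \<and>
     A\<^sub>1 \<inter> A\<^sub>2 = {} \<and> A\<^sub>1 \<inter> A\<^sub>3 = {} \<and> A\<^sub>2 \<inter> A\<^sub>3 = {} \<and>
     T \<subseteq> A\<^sub>1 \<times> A\<^sub>2 \<times> A\<^sub>3 \<and>
     (\<forall>x\<in>T. \<forall>y\<in>T.
        card {r \<in> {1, 2, 3}. coord r x = coord r y} \<le> 1 \<or>
        (\<forall>r\<in>{1, 2, 3}. coord r x = coord r y)) \<and>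
     (\<forall>x \<in> A\<^sub>1 \<union> A\<^sub>2 \<union> A\<^sub>3. \<exists>t\<in>T. \<exists>r\<in>{1, 2, 3}. coord r t = x)"

text \<open>
  In the following definitions \<open>T\<close> and \<open>S\<close> are the two mates of the bitrade,
  usually written with a superscript circle and star, respectively.
\<close>

definition latin_bitrade ::
  "'a set \<Rightarrow> 'a set \<Rightarrow> 'a set \<Rightarrow> ('a \<times> 'a \<times> 'a) set \<Rightarrow> ('a \<times> 'a \<times> 'a) set \<Rightarrow> bool" where
  "latin_bitrade A\<^sub>1 A\<^sub>2 A\<^sub>3 T S \<longleftrightarrow>
     partial_latin_square A\<^sub>1 A\<^sub>2 A\<^sub>3 T \<and> partial_latin_square A\<^sub>1 A\<^sub>2 A\<^sub>3 S \<and>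
     T \<inter> S = {} \<and>
     (\<forall>x\<in>T. \<forall>r\<in>{1, 2, 3}. \<forall>s\<in>{1, 2, 3}. r \<noteq> s \<longrightarrow>
        (\<exists>!y. y \<in> S \<and> coord r x = coord r y \<and> coord s x = coord s y)) \<and>
     (\<forall>x\<in>S. \<forall>r\<in>{1, 2, 3}. \<forall>s\<in>{1, 2, 3}. r \<noteq> s \<longrightarrow>
        (\<exists>!y. y \<in> T \<and> coord r x = coord r y \<and> coord s x = coord s y))"

definition primary_bitrade :: "('a \<times> 'a \<times> 'a) set \<Rightarrow> ('a \<times> 'a \<times> 'a) set \<Rightarrow> bool" where
  "primary_bitrade T S \<longleftrightarrow>
     (\<forall>B\<^sub>1 B\<^sub>2 B\<^sub>3 U V. latin_bitrade B\<^sub>1 B\<^sub>2 B\<^sub>3 U V \<and> U \<subseteq> T \<and> V \<subseteq> S \<longrightarrow> (U, V) = (T, S))"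

definition homogeneous_bitrade ::
  "nat \<Rightarrow> 'a set \<Rightarrow> 'a set \<Rightarrow> 'a set \<Rightarrow> ('a \<times> 'a \<times> 'a) set \<Rightarrow> bool" where
  "homogeneous_bitrade k A\<^sub>1 A\<^sub>2 A\<^sub>3 T \<longleftrightarrow>
     (\<forall>x\<in>A\<^sub>1. card {t \<in> T. coord 1 t = x} = k) \<and>
     (\<forall>x\<in>A\<^sub>2. card {t \<in> T. coord 2 t = x} = k) \<and>
     (\<forall>x\<in>A\<^sub>3. card {t \<in> T. coord 3 t = x} = k)"

end

theory Submission
  imports Defs
begin

text \<open>
  For the bitrade, the essential input from the group is that three cyclic subgroups with
  \<open>\<alpha>\<beta>\<gamma> = 1\<close> meet pairwise trivially: an entry is then determined by any two of its cosets, and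
  since \<open>\<alpha>\<inverse>\<langle>\<gamma>\<rangle> = \<beta>\<langle>\<gamma>\<rangle>\<close> the mates of the entry indexed by \<open>g\<close> are indexed by
  \<open>g\<close>, \<open>g\<alpha>\<close>, \<open>g\<beta>\<inverse>\<close> (or \<open>g\<close>, \<open>g\<alpha>\<inverse>\<close>, \<open>g\<beta>\<close> in the other direction). A subtrade is thus
  closed under right multiplication by \<open>\<alpha>\<close> and \<open>\<beta>\<close>, and these generate the group, so the bitrade is primary.
  The word problem in the group is solved by evaluating words in the integer Heisenberg group
  and reducing the coordinates modulo \<open>p\<close>; the relations put each word into the normal form
  \<open>b\<^sup>y a\<^sup>x c\<^sup>z\<close> with these coordinates.
\<close>

section \<open>Latin bitrades from three cyclic subgroups\<close>

lemma (in group) l_coset_eq_iff: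
  assumes "subgroup H G" "g \<in> carrier G" "h \<in> carrier G"
  shows "g <# H = h <# H \<longleftrightarrow> inv g \<otimes> h \<in> H"
proof -
  have "g <# H = h <# H \<longleftrightarrow> h \<in> g <# H"
    using assms lcos_self l_repr_independence by metis
  also have "\<dots> \<longleftrightarrow> inv g \<otimes> h \<in> H"
    using assms by (meson group_axioms subgroup.lcos_module_imp subgroup.lcos_module_rev)
  finally show ?thesis .
qed

lemma (in group) l_coset_mult_eq:
  assumes "subgroup H G" "g \<in> carrier G" "h \<in> H"
  shows "(g \<otimes> h) <# H = g <# H"
  using assms l_coset_eq_iff[of H g "g \<otimes> h"] subgroup.mem_carrier[OF assms(1,3)]
  by (simp add: m_assoc[symmetric])

text \<open>\<open>inv g \<otimes> h\<close> lies in both subgroups, hence is \<open>\<one>\<close>.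
  This is how trivial intersection lets two coordinates determine an entry.\<close>

lemma (in group) eq_if_l_cosets_eq:
  assumes "subgroup H G" "subgroup K G" "H \<inter> K = {\<one>}"
    and "g \<in> carrier G" "h \<in> carrier G" "g <# H = h <# H" "g <# K = h <# K"
  shows "g = h"
proof -
  have "inv g \<otimes> h \<in> H" "inv g \<otimes> h \<in> K"
    using assms by (simp_all add: l_coset_eq_iff)
  then have "inv g \<otimes> h = \<one>"
    using assms(3) by blast
  then have "inv h = inv g"
    using assms(4,5) by (simp add: inv_equality)
  then show ?thesis
    using assms(4,5) by (metis inv_inv)
qed

text \<open>A coset remembers its subgroup: if \<open>g <# H = h <# K\<close>, then \<open>g\<close>
  lies in the latter, which thus equals \<open>g <# K\<close>, and \<open>g\<close> cancels. Rows,
  columns and symbols are all subsets of one group, and this keeps the three families apart.\<close>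

lemma (in group) lcosets_disjoint:
  assumes "subgroup H G" "subgroup K G" "H \<noteq> K"
  shows "lcosets H \<inter> lcosets K = {}"
proof (rule ccontr)
  assume "\<not> ?thesis"
  then obtain g h where gh: "g \<in> carrier G" "h \<in> carrier G" "g <# H = h <# K"
    by (auto simp: LCOSETS_def)
  then have "g \<in> h <# K"
    using lcos_self[OF gh(1) assms(1)] by simp
  then have "g <# H = g <# K"
    using gh assms(2) l_repr_independence by metis
  moreover have "inv g <# (g <# M) = M" if "subgroup M G" for M
    using subgroup.subset[OF that] gh(1) by (simp add: lcos_m_assoc lcos_mult_one)
  ultimately show False
    using assms by metis
qed

section \<open>A criterion for partial latin squares\<close>

lemma card_le_1_cases:
  assumes "\<And>r s. r \<in> I \<Longrightarrow> s \<in> I \<Longrightarrow> r \<noteq> s \<Longrightarrow> P r \<Longrightarrow> P s \<Longrightarrow> Q"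
  shows "card {r \<in> I. P r} \<le> 1 \<or> Q"
proof (cases Q)
  case False
  then obtain r where "{r \<in> I. P r} \<subseteq> {r}"
    using assms by blast
  then have "card {r \<in> I. P r} \<le> card {r}"
    by (intro card_mono) auto
  then show ?thesis
    by simp
qed simp

text \<open>Two agreeing coordinates force equal entries, which gives \<open>P1\<close>, and
  coordinate maps that are onto give \<open>P2\<close>. Both forms are easy to check for entries
  indexed by group elements.\<close>

lemma partial_latin_squareI:
  assumes "finite A\<^sub>1" "finite A\<^sub>2" "finite A\<^sub>3" "A\<^sub>1 \<noteq> {}" "A\<^sub>2 \<noteq> {}" "A\<^sub>3 \<noteq> {}"
    and "A\<^sub>1 \<inter> A\<^sub>2 = {}" "A\<^sub>1 \<inter> A\<^sub>3 = {}" "A\<^sub>2 \<inter> A\<^sub>3 = {}"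
    and "T \<subseteq> A\<^sub>1 \<times> A\<^sub>2 \<times> A\<^sub>3"
    and unique: "\<And>r s x y. r \<in> {1, 2, 3} \<Longrightarrow> s \<in> {1, 2, 3} \<Longrightarrow> r \<noteq> s \<Longrightarrow> x \<in> T \<Longrightarrow> y \<in> T
      \<Longrightarrow> coord r x = coord r y \<Longrightarrow> coord s x = coord s y \<Longrightarrow> x = y"
    and cover: "A\<^sub>1 \<subseteq> coord 1 ` T" "A\<^sub>2 \<subseteq> coord 2 ` T" "A\<^sub>3 \<subseteq> coord 3 ` T"
  shows "partial_latin_square A\<^sub>1 A\<^sub>2 A\<^sub>3 T"
proof -
  have P1: "card {r \<in> {1, 2, 3}. coord r x = coord r y} \<le> 1 \<or>
      (\<forall>r\<in>{1, 2, 3}. coord r x = coord r y)" if "x \<in> T" "y \<in> T" for x y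
  proof (rule card_le_1_cases)
    fix r s :: nat
    assume "r \<in> {1, 2, 3}" "s \<in> {1, 2, 3}" "r \<noteq> s" "coord r x = coord r y" "coord s x = coord s y"
    then have "x = y"
      using unique that by blast
    then show "\<forall>r\<in>{1, 2, 3}. coord r x = coord r y"
      by simp
  qed
  have P2: "\<exists>t\<in>T. \<exists>r\<in>{1, 2, 3}. coord r t = x" if x: "x \<in> A\<^sub>1 \<union> A\<^sub>2 \<union> A\<^sub>3" for x
    using x cover by blast
  show ?thesis
    unfolding partial_latin_square_def by (intro conjI ballI assms(1-10) P1 P2)
qed

section \<open>Three cyclic subgroups and the entries indexed by group elements\<close>

locale separated_triple = group G for G (structure) +
  fixes \<alpha> \<beta> \<gamma> A B C
  assumes finite_carrier: "finite (carrier G)"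
    and closed [simp]: "\<alpha> \<in> carrier G" "\<beta> \<in> carrier G" "\<gamma> \<in> carrier G"
    and prod_eq_one: "\<alpha> \<otimes> \<beta> \<otimes> \<gamma> = \<one>"
    and nontrivial: "\<alpha> \<noteq> \<one>" "\<beta> \<noteq> \<one>"
    and A_def: "A = generate G {\<alpha>}" and B_def: "B = generate G {\<beta>}"
    and C_def: "C = generate G {\<gamma>}"
    and Int_eq: "A \<inter> B = {\<one>}" "A \<inter> C = {\<one>}" "B \<inter> C = {\<one>}"
begin

definition circ where "circ g = (g <# A, g <# B, g <# C)"
definition star where "star g = (g <# A, g <# B, (g \<otimes> inv \<alpha>) <# C)"

lemma subgroups: "subgroup A G" "subgroup B G" "subgroup C G"
  unfolding A_def B_def C_def by (simp_all add: generate_is_subgroup)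

lemma generator_mem: "\<alpha> \<in> A" "\<beta> \<in> B" "\<gamma> \<in> C"
  unfolding A_def B_def C_def by (auto intro: generate.incl)

lemma inv_generator_mem: "inv \<alpha> \<in> A" "inv \<beta> \<in> B" "inv \<gamma> \<in> C"
  by (rule subgroup.m_inv_closed[OF subgroups(1) generator_mem(1)]
      subgroup.m_inv_closed[OF subgroups(2) generator_mem(2)]
      subgroup.m_inv_closed[OF subgroups(3) generator_mem(3)])+

lemma inv_\<alpha>: "inv \<alpha> = \<beta> \<otimes> \<gamma>"
proof -
  have "inv (\<beta> \<otimes> \<gamma>) = \<alpha>"
    by (rule inv_equality) (use prod_eq_one in \<open>simp_all add: m_assoc\<close>)
  then show ?thesis
    by (metis closed(2,3) inv_inv m_closed)
qed

text \<open>Since \<open>inv \<alpha> = \<beta> \<otimes> \<gamma>\<close> and \<open>C\<close>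
  absorbs \<open>\<gamma>\<close>, the third coordinate of \<open>star\<close> is a shift by
  \<open>inv \<alpha>\<close>, which fixes cosets of \<open>A\<close>, and equally a shift by
  \<open>\<beta>\<close>, which fixes cosets of \<open>B\<close>.\<close>

lemma l_coset_inv_\<alpha>: "g \<in> carrier G \<Longrightarrow> (g \<otimes> inv \<alpha>) <# C = (g \<otimes> \<beta>) <# C"
  using l_coset_mult_eq[OF subgroups(3), of "g \<otimes> \<beta>" \<gamma>] generator_mem
  by (simp add: inv_\<alpha> m_assoc)

lemma l_coset_mult_generator:
  assumes "g \<in> carrier G"
  shows "(g \<otimes> \<alpha>) <# A = g <# A" "(g \<otimes> inv \<alpha>) <# A = g <# A"
    "(g \<otimes> \<beta>) <# B = g <# B" "(g \<otimes> inv \<beta>) <# B = g <# B"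
  by (rule l_coset_mult_eq assms subgroups generator_mem inv_generator_mem)+

lemma eq_if_cosets:
  assumes "g \<in> carrier G" "h \<in> carrier G"
  shows "g <# A = h <# A \<Longrightarrow> g <# B = h <# B \<Longrightarrow> g = h"
    "g <# A = h <# A \<Longrightarrow> g <# C = h <# C \<Longrightarrow> g = h"
    "g <# B = h <# B \<Longrightarrow> g <# C = h <# C \<Longrightarrow> g = h"
  using eq_if_l_cosets_eq[OF subgroups(1,2) Int_eq(1) assms]
    eq_if_l_cosets_eq[OF subgroups(1,3) Int_eq(2) assms]
    eq_if_l_cosets_eq[OF subgroups(2,3) Int_eq(3) assms] by blast+

lemma circ_unique:
  assumes "g \<in> carrier G" "h \<in> carrier G" "r \<in> {1, 2, 3}" "s \<in> {1, 2, 3}" "r \<noteq> s"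
    and "coord r (circ g) = coord r (circ h)" "coord s (circ g) = coord s (circ h)"
  shows "g = h"
  using assms eq_if_cosets[of g h] by (auto simp: circ_def)

text \<open>When the third coordinate takes part, both elements are first moved without changing
  their other coordinate: by \<open>inv \<alpha>\<close> beside \<open>A\<close>, by
  \<open>\<beta>\<close> beside \<open>B\<close>. Then \<open>eq_if_cosets\<close> applies and the
  shift cancels.\<close>

lemma star_unique:
  assumes gh: "g \<in> carrier G" "h \<in> carrier G" and rs: "r \<in> {1, 2, 3}" "s \<in> {1, 2, 3}" "r \<noteq> s"
    and eq: "coord r (star g) = coord r (star h)" "coord s (star g) = coord s (star h)"
  shows "g = h"
proof -
  have "g = h" if "g <# A = h <# A" "(g \<otimes> inv \<alpha>) <# C = (h \<otimes> inv \<alpha>) <# C"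
    using eq_if_cosets(2)[of "g \<otimes> inv \<alpha>" "h \<otimes> inv \<alpha>"] that gh
    by (simp add: l_coset_mult_generator)
  moreover have "g = h" if "g <# B = h <# B" "(g \<otimes> inv \<alpha>) <# C = (h \<otimes> inv \<alpha>) <# C"
    using eq_if_cosets(3)[of "g \<otimes> \<beta>" "h \<otimes> \<beta>"] that gh
    by (simp add: l_coset_mult_generator l_coset_inv_\<alpha>)
  moreover have "g = h" if "g <# A = h <# A" "g <# B = h <# B"
    using eq_if_cosets(1) that gh by blast
  ultimately show ?thesis
    using rs eq by (auto simp: star_def)
qed

lemma circ_inj: "inj_on circ (carrier G)"
  by (rule inj_onI, rule circ_unique[of _ _ 1 2]) auto

lemma star_inj: "inj_on star (carrier G)"
  by (rule inj_onI, rule star_unique[of _ _ 1 2]) auto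

lemma circ_star_agree:
  assumes "g \<in> carrier G"
  shows "coord 1 (circ g) = coord 1 (star g)" "coord 2 (circ g) = coord 2 (star g)"
    "coord 1 (circ g) = coord 1 (star (g \<otimes> \<alpha>))" "coord 3 (circ g) = coord 3 (star (g \<otimes> \<alpha>))"
    "coord 2 (circ g) = coord 2 (star (g \<otimes> inv \<beta>))" "coord 3 (circ g) = coord 3 (star (g \<otimes> inv \<beta>))"
proof -
  have "g \<otimes> \<alpha> \<otimes> inv \<alpha> = g" "g \<otimes> inv \<beta> \<otimes> \<beta> = g"
    using assms by (simp_all add: m_assoc)
  \<comment> \<open>Reading the third coordinate of \<open>star (g \<otimes> inv \<beta>)\<close> as
    a shift by \<open>\<beta>\<close> collapses it to \<open>g <# C\<close>.\<close>
  moreover from this have "(g \<otimes> inv \<beta> \<otimes> inv \<alpha>) <# C = g <# C"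
    using assms l_coset_inv_\<alpha>[of "g \<otimes> inv \<beta>"] by simp
  ultimately show "coord 1 (circ g) = coord 1 (star g)" "coord 2 (circ g) = coord 2 (star g)"
    "coord 1 (circ g) = coord 1 (star (g \<otimes> \<alpha>))" "coord 3 (circ g) = coord 3 (star (g \<otimes> \<alpha>))"
    "coord 2 (circ g) = coord 2 (star (g \<otimes> inv \<beta>))" "coord 3 (circ g) = coord 3 (star (g \<otimes> inv \<beta>))"
    using assms by (simp_all add: circ_def star_def l_coset_mult_generator)
qed

lemma star_circ_agree:
  assumes "g \<in> carrier G"
  shows "coord 1 (star g) = coord 1 (circ g)" "coord 2 (star g) = coord 2 (circ g)"
    "coord 1 (star g) = coord 1 (circ (g \<otimes> inv \<alpha>))" "coord 3 (star g) = coord 3 (circ (g \<otimes> inv \<alpha>))"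
    "coord 2 (star g) = coord 2 (circ (g \<otimes> \<beta>))" "coord 3 (star g) = coord 3 (circ (g \<otimes> \<beta>))"
  using assms by (simp_all add: circ_def star_def l_coset_mult_generator l_coset_inv_\<alpha>)

text \<open>The first two coordinates force \<open>g = h\<close>; the third then puts
  \<open>g\<close> and \<open>g \<otimes> inv \<alpha>\<close> in one coset of \<open>C\<close>.
  They also share one of \<open>A\<close>, so they coincide, against
  \<open>\<alpha> \<noteq> \<one>\<close>.\<close>

lemma circ_neq_star:
  assumes "g \<in> carrier G" "h \<in> carrier G"
  shows "circ g \<noteq> star h"
proof
  assume eq: "circ g = star h"
  then have "g = h"
    using eq_if_cosets(1) assms by (simp add: circ_def star_def)
  then have "(g \<otimes> inv \<alpha>) <# C = g <# C" "(g \<otimes> inv \<alpha>) <# A = g <# A"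
    using eq assms by (simp_all add: circ_def star_def l_coset_mult_generator)
  then have "g \<otimes> inv \<alpha> = g"
    using eq_if_cosets(2) assms by simp
  then show False
    using nontrivial(1) assms(1) by simp
qed

lemma lcosets_eqs:
  "lcosets A = coord 1 ` circ ` carrier G" "lcosets B = coord 2 ` circ ` carrier G"
  "lcosets C = coord 3 ` circ ` carrier G"
  by (simp_all add: LCOSETS_def circ_def image_image UNION_singleton_eq_range)

lemma lcosets_eqs_star:
  "lcosets A = coord 1 ` star ` carrier G" "lcosets B = coord 2 ` star ` carrier G"
  "lcosets C = coord 3 ` star ` carrier G"
proof -
  \<comment> \<open>Right translation permutes the group, so the shifted third coordinate still runs
    through all cosets of \<open>C\<close>.\<close>
  have "(\<lambda>g. g \<otimes> inv \<alpha>) ` carrier G = carrier G"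
  proof (intro equalityI subsetI)
    fix g
    assume "g \<in> carrier G"
    then show "g \<in> (\<lambda>g. g \<otimes> inv \<alpha>) ` carrier G"
      by (intro image_eqI[of _ _ "g \<otimes> \<alpha>"]) (simp_all add: m_assoc)
  qed auto
  then have "lcosets C = (\<lambda>g. g <# C) ` (\<lambda>g. g \<otimes> inv \<alpha>) ` carrier G"
    by (simp add: LCOSETS_def UNION_singleton_eq_range)
  then show "lcosets C = coord 3 ` star ` carrier G"
    by (simp add: star_def image_image)
qed (simp_all add: LCOSETS_def star_def image_image UNION_singleton_eq_range)

lemma lcosets_Int: "lcosets A \<inter> lcosets B = {}" "lcosets A \<inter> lcosets C = {}"
    "lcosets B \<inter> lcosets C = {}"
proof -
  \<comment> \<open>Equal subgroups would have \<open>\<alpha>\<close> or \<open>\<beta>\<close> in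
    their intersection.\<close>
  have "A \<noteq> B" "A \<noteq> C" "B \<noteq> C"
    using Int_eq generator_mem nontrivial by auto
  then show "lcosets A \<inter> lcosets B = {}" "lcosets A \<inter> lcosets C = {}"
    "lcosets B \<inter> lcosets C = {}"
    by (simp_all add: lcosets_disjoint subgroups)
qed

lemma lcosets_finite: "finite (lcosets A)" "finite (lcosets B)" "finite (lcosets C)"
  unfolding lcosets_eqs using finite_carrier by simp_all

lemma lcosets_nonempty: "lcosets A \<noteq> {}" "lcosets B \<noteq> {}" "lcosets C \<noteq> {}"
  unfolding lcosets_eqs using carrier_not_empty by simp_all

section \<open>The bitrade axioms for the two sets of entries\<close>

lemma partial_latin_square_circ:
  "partial_latin_square (lcosets A) (lcosets B) (lcosets C) (circ ` carrier G)"
proof (rule partial_latin_squareI[OF lcosets_finite lcosets_nonempty lcosets_Int])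
  show "circ ` carrier G \<subseteq> (lcosets A) \<times> (lcosets B) \<times> (lcosets C)"
    by (auto simp: circ_def LCOSETS_def)
  fix r s x y
  assume rs: "r \<in> {1, 2, 3}" "s \<in> {1, 2, 3}" "r \<noteq> s"
    and "x \<in> circ ` carrier G" "y \<in> circ ` carrier G" "coord r x = coord r y" "coord s x = coord s y"
  then obtain g h where gh: "g \<in> carrier G" "h \<in> carrier G"
    "coord r (circ g) = coord r (circ h)" "coord s (circ g) = coord s (circ h)" and "x = circ g" "y = circ h"
    by blast
  moreover have "g = h"
    using gh by (rule circ_unique[OF _ _ rs])
  ultimately show "x = y"
    by simp
qed (simp_all add: lcosets_eqs)

lemma partial_latin_square_star:
  "partial_latin_square (lcosets A) (lcosets B) (lcosets C) (star ` carrier G)"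
proof (rule partial_latin_squareI[OF lcosets_finite lcosets_nonempty lcosets_Int])
  show "star ` carrier G \<subseteq> (lcosets A) \<times> (lcosets B) \<times> (lcosets C)"
    by (fastforce simp: star_def LCOSETS_def)
  fix r s x y
  assume rs: "r \<in> {1, 2, 3}" "s \<in> {1, 2, 3}" "r \<noteq> s"
    and "x \<in> star ` carrier G" "y \<in> star ` carrier G" "coord r x = coord r y" "coord s x = coord s y"
  then obtain g h where gh: "g \<in> carrier G" "h \<in> carrier G"
    "coord r (star g) = coord r (star h)" "coord s (star g) = coord s (star h)" and "x = star g" "y = star h"
    by blast
  moreover have "g = h"
    using gh by (rule star_unique[OF _ _ rs])
  ultimately show "x = y"
    by simp
qed (simp_all add: lcosets_eqs_star)

lemma circ_ex_star:
  assumes "g \<in> carrier G" "r \<in> {1, 2, 3}" "s \<in> {1, 2, 3}" "r \<noteq> s"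
  shows "\<exists>h\<in>carrier G. coord r (circ g) = coord r (star h) \<and> coord s (circ g) = coord s (star h)"
proof -
  \<comment> \<open>The omitted coordinate selects the index of the mate: \<open>g\<close> for the
    symbol, \<open>g \<otimes> \<alpha>\<close> for the column,
    \<open>g \<otimes> inv \<beta>\<close> for the row.\<close>
  consider "r \<noteq> 3" "s \<noteq> 3" | "r \<noteq> 2" "s \<noteq> 2" | "r \<noteq> 1" "s \<noteq> 1"
    using assms(2-4) by fastforce
  then show ?thesis
  proof cases
    case 1
    then show ?thesis
      using assms circ_star_agree(1,2) by (intro bexI[of _ g]) auto
  next
    case 2
    then show ?thesis
      using assms circ_star_agree(3,4) by (intro bexI[of _ "g \<otimes> \<alpha>"]) auto
  next
    case 3
    then show ?thesis
      using assms circ_star_agree(5,6) by (intro bexI[of _ "g \<otimes> inv \<beta>"]) auto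
  qed
qed

lemma star_ex_circ:
  assumes "g \<in> carrier G" "r \<in> {1, 2, 3}" "s \<in> {1, 2, 3}" "r \<noteq> s"
  shows "\<exists>h\<in>carrier G. coord r (star g) = coord r (circ h) \<and> coord s (star g) = coord s (circ h)"
proof -
  consider "r \<noteq> 3" "s \<noteq> 3" | "r \<noteq> 2" "s \<noteq> 2" | "r \<noteq> 1" "s \<noteq> 1"
    using assms(2-4) by fastforce
  then show ?thesis
  proof cases
    case 1
    then show ?thesis
      using assms star_circ_agree(1,2) by (intro bexI[of _ g]) auto
  next
    case 2
    then show ?thesis
      using assms star_circ_agree(3,4) by (intro bexI[of _ "g \<otimes> inv \<alpha>"]) auto
  next
    case 3
    then show ?thesis
      using assms star_circ_agree(5,6) by (intro bexI[of _ "g \<otimes> \<beta>"]) auto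
  qed
qed

theorem latin_bitrade_circ_star:
  "latin_bitrade (lcosets A) (lcosets B) (lcosets C) (circ ` carrier G) (star ` carrier G)"
proof -
  have R2: "\<exists>!y. y \<in> star ` carrier G \<and> coord r x = coord r y \<and> coord s x = coord s y"
    if x: "x \<in> circ ` carrier G" and rs: "r \<in> {1, 2, 3}" "s \<in> {1, 2, 3}" "r \<noteq> s" for x r s
  proof -
    obtain g where g: "g \<in> carrier G" "x = circ g"
      using x by blast
    obtain h where h: "h \<in> carrier G" "coord r x = coord r (star h)" "coord s x = coord s (star h)"
      using circ_ex_star[OF g(1) rs] g(2) by blast
    show ?thesis
    proof (rule ex1I[of _ "star h"])
      fix y
      assume y: "y \<in> star ` carrier G \<and> coord r x = coord r y \<and> coord s x = coord s y"
      then obtain g where g: "g \<in> carrier G" "y = star g"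
        by blast
      then have "coord r (star g) = coord r (star h)" "coord s (star g) = coord s (star h)"
        using h y by simp_all
      then have "g = h"
        by (rule star_unique[OF g(1) h(1) rs])
      then show "y = star h"
        using g(2) by simp
    qed (use h in simp)
  qed
  have R3: "\<exists>!y. y \<in> circ ` carrier G \<and> coord r x = coord r y \<and> coord s x = coord s y"
    if x: "x \<in> star ` carrier G" and rs: "r \<in> {1, 2, 3}" "s \<in> {1, 2, 3}" "r \<noteq> s" for x r s
  proof -
    obtain g where g: "g \<in> carrier G" "x = star g"
      using x by blast
    obtain h where h: "h \<in> carrier G" "coord r x = coord r (circ h)" "coord s x = coord s (circ h)"
      using star_ex_circ[OF g(1) rs] g(2) by blast
    show ?thesis
    proof (rule ex1I[of _ "circ h"])
      fix y
      assume y: "y \<in> circ ` carrier G \<and> coord r x = coord r y \<and> coord s x = coord s y"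
      then obtain g where g: "g \<in> carrier G" "y = circ g"
        by blast
      then have "coord r (circ g) = coord r (circ h)" "coord s (circ g) = coord s (circ h)"
        using h y by simp_all
      then have "g = h"
        by (rule circ_unique[OF g(1) h(1) rs])
      then show "y = circ h"
        using g(2) by simp
    qed (use h in simp)
  qed
  have "circ ` carrier G \<inter> star ` carrier G = {}"
    using circ_neq_star by blast
  then show ?thesis
    unfolding latin_bitrade_def
    by (intro conjI ballI impI partial_latin_square_circ partial_latin_square_star R2 R3)
qed

section \<open>Absence of proper subtrades\<close>

theorem primary_bitrade_circ_star:
  assumes gen: "generate G {\<alpha>, \<beta>} = carrier G"
  shows "primary_bitrade (circ ` carrier G) (star ` carrier G)"
  unfolding primary_bitrade_def
proof (intro allI impI, elim conjE)
  fix B\<^sub>1 B\<^sub>2 B\<^sub>3 U V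
  assume trade: "latin_bitrade B\<^sub>1 B\<^sub>2 B\<^sub>3 U V"
    and U: "U \<subseteq> circ ` carrier G" and V: "V \<subseteq> star ` carrier G"
  have R2: "\<forall>x\<in>U. \<forall>r\<in>{1, 2, 3}. \<forall>s\<in>{1, 2, 3}. r \<noteq> s \<longrightarrow>
      (\<exists>!y. y \<in> V \<and> coord r x = coord r y \<and> coord s x = coord s y)"
    and R3: "\<forall>x\<in>V. \<forall>r\<in>{1, 2, 3}. \<forall>s\<in>{1, 2, 3}. r \<noteq> s \<longrightarrow>
      (\<exists>!y. y \<in> U \<and> coord r x = coord r y \<and> coord s x = coord s y)"
    using trade unfolding latin_bitrade_def by - (elim conjE, assumption)+
  \<comment> \<open>\<open>R2\<close> yields some mate in \<open>V\<close>; it has the form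
    \<open>star k\<close>, and the two shared coordinates force \<open>k = h\<close>. The mate known
    from the full bitrade must therefore lie in \<open>V\<close>.\<close>
  have star_mem: "star h \<in> V"
    if hyps: "circ g \<in> U" "h \<in> carrier G" "r \<in> {1, 2, 3}" "s \<in> {1, 2, 3}" "r \<noteq> s"
      "coord r (circ g) = coord r (star h)" "coord s (circ g) = coord s (star h)" for g h r s
  proof -
    obtain y where "y \<in> V" and y: "coord r (circ g) = coord r y" "coord s (circ g) = coord s y"
      using R2[rule_format, OF hyps(1,3-5)] by blast
    moreover from this obtain k where k: "k \<in> carrier G" "y = star k"
      using V by blast
    moreover have "h = k"
      by (rule star_unique[OF hyps(2) k(1) hyps(3-5)]) (use hyps(6,7) y k(2) in simp_all)
    ultimately show ?thesis
      by simp
  qed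
  have circ_mem: "circ h \<in> U"
    if hyps: "star g \<in> V" "h \<in> carrier G" "r \<in> {1, 2, 3}" "s \<in> {1, 2, 3}" "r \<noteq> s"
      "coord r (star g) = coord r (circ h)" "coord s (star g) = coord s (circ h)" for g h r s
  proof -
    obtain y where "y \<in> U" and y: "coord r (star g) = coord r y" "coord s (star g) = coord s y"
      using R3[rule_format, OF hyps(1,3-5)] by blast
    moreover from this obtain k where k: "k \<in> carrier G" "y = circ k"
      using U by blast
    moreover have "h = k"
      by (rule circ_unique[OF hyps(2) k(1) hyps(3-5)]) (use hyps(6,7) y k(2) in simp_all)
    ultimately show ?thesis
      by simp
  qed
  have star_U: "star g \<in> V" if "circ g \<in> U" "g \<in> carrier G" for g
    using star_mem[of g g 1 2] that circ_star_agree by simp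
  \<comment> \<open>Each step changes mates twice: through \<open>star g\<close> for
    \<open>inv \<alpha>\<close> and \<open>\<beta>\<close>, and through the \<open>star\<close>
    entry with the new index for \<open>\<alpha>\<close> and \<open>inv \<beta>\<close>.\<close>
  have step: "circ (g \<otimes> k) \<in> U"
    if hyps: "circ g \<in> U" "g \<in> carrier G" "k \<in> {\<alpha>, \<beta>, inv \<alpha>, inv \<beta>}" for g k
  proof -
    have "circ (g \<otimes> inv \<alpha>) \<in> U"
      using circ_mem[of g "g \<otimes> inv \<alpha>" 1 3] star_U hyps star_circ_agree by simp
    moreover have "circ (g \<otimes> \<beta>) \<in> U"
      using circ_mem[of g "g \<otimes> \<beta>" 2 3] star_U hyps star_circ_agree by simp
    moreover have "star (g \<otimes> \<alpha>) \<in> V"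
      using star_mem[of g "g \<otimes> \<alpha>" 1 3] hyps circ_star_agree by simp
    then have "circ (g \<otimes> \<alpha>) \<in> U"
      using circ_mem[of "g \<otimes> \<alpha>" "g \<otimes> \<alpha>" 1 2] hyps star_circ_agree by simp
    moreover have "star (g \<otimes> inv \<beta>) \<in> V"
      using star_mem[of g "g \<otimes> inv \<beta>" 2 3] hyps circ_star_agree by simp
    then have "circ (g \<otimes> inv \<beta>) \<in> U"
      using circ_mem[of "g \<otimes> inv \<beta>" "g \<otimes> inv \<beta>" 1 2] hyps star_circ_agree by simp
    ultimately show ?thesis
      using hyps(3) by blast
  qed
  \<comment> \<open>The starting point \<open>g\<close> stays arbitrary because the second factor of
    \<open>h1 \<otimes> h2\<close> is walked from \<open>g \<otimes> h1\<close>.\<close>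
  have walk: "circ (g \<otimes> k) \<in> U" if "k \<in> generate G {\<alpha>, \<beta>}" "circ g \<in> U" "g \<in> carrier G" for g k
    using that
  proof (induction k arbitrary: g rule: generate.induct)
    case one
    then show ?case
      by simp
  next
    case (incl h)
    then show ?case
      using step[of g h] by blast
  next
    case (inv h)
    then show ?case
      using step[of g "inv h"] by blast
  next
    case (eng h1 h2)
    have h: "h1 \<in> carrier G" "h2 \<in> carrier G"
      using eng.hyps by (simp_all add: gen)
    have "circ (g \<otimes> h1 \<otimes> h2) \<in> U"
      using eng.IH eng.prems h by simp
    then show ?case
      using eng.prems h by (simp add: m_assoc)
  qed
  \<comment> \<open>The subtrade has at least one row, and that row occurs in some entry of
    \<open>U\<close>: this is where the walk starts.\<close>
  have "partial_latin_square B\<^sub>1 B\<^sub>2 B\<^sub>3 U"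
    using trade unfolding latin_bitrade_def by (elim conjE)
  then have "B\<^sub>1 \<noteq> {}"
    "\<forall>x \<in> B\<^sub>1 \<union> B\<^sub>2 \<union> B\<^sub>3. \<exists>t\<in>U. \<exists>r\<in>{1, 2, 3}. coord r t = x"
    unfolding partial_latin_square_def by - (elim conjE, assumption)+
  then have "U \<noteq> {}"
    by blast
  then obtain g\<^sub>0 where g\<^sub>0: "g\<^sub>0 \<in> carrier G" "circ g\<^sub>0 \<in> U"
    using U by blast
  have "circ g \<in> U" if "g \<in> carrier G" for g
  proof -
    have "circ (g\<^sub>0 \<otimes> (inv g\<^sub>0 \<otimes> g)) \<in> U"
      using g\<^sub>0 that by (intro walk) (simp_all add: gen)
    then show ?thesis
      using g\<^sub>0 that by (simp add: m_assoc[symmetric])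
  qed
  then show "(U, V) = (circ ` carrier G, star ` carrier G)"
    using U V star_U by blast
qed

section \<open>Numbers of entries per row, column and symbol\<close>

text \<open>The entries with coordinate \<open>D\<close> are the \<open>circ g\<close> with
  \<open>g \<in> D\<close>. As \<open>circ\<close> is injective, there are as many of them as
  elements of the coset. Keeping \<open>r\<close> and \<open>H\<close> generic serves all three
  coordinates at once.\<close>

lemma card_fibre:
  assumes H: "subgroup H G" and coord: "\<And>g. coord r (circ g) = g <# H" and D: "D \<in> lcosets H"
  shows "card {t \<in> circ ` carrier G. coord r t = D} = card H"
proof -
  obtain x where x: "x \<in> carrier G" "D = x <# H"
    using D by (auto simp: LCOSETS_def)
  have sub: "D \<subseteq> carrier G"
    using H x l_coset_carrier by blast
  have "coord r (circ g) = D \<longleftrightarrow> g \<in> D" if "g \<in> carrier G" for g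
    using H x that lcos_self l_repr_independence coord by metis
  then have "{t \<in> circ ` carrier G. coord r t = D} = circ ` D"
    using sub by blast
  then have "card {t \<in> circ ` carrier G. coord r t = D} = card D"
    using circ_inj sub by (simp add: card_image inj_on_subset)
  also have "\<dots> = card H"
    using l_card_cosets_equal[OF D subgroup.subset[OF H] finite_carrier] by simp
  finally show ?thesis .
qed

theorem homogeneous_circ:
  assumes "card A = k" "card B = k" "card C = k"
  shows "homogeneous_bitrade k (lcosets A) (lcosets B) (lcosets C) (circ ` carrier G)"
  unfolding homogeneous_bitrade_def
proof (intro conjI ballI)
  show "card {t \<in> circ ` carrier G. coord 1 t = x} = k" if "x \<in> lcosets A" for x
    using card_fibre[OF subgroups(1) _ that, of 1] assms(1) by (simp add: circ_def)
  show "card {t \<in> circ ` carrier G. coord 2 t = x} = k" if "x \<in> lcosets B" for x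
    using card_fibre[OF subgroups(2) _ that, of 2] assms(2) by (simp add: circ_def)
  show "card {t \<in> circ ` carrier G. coord 3 t = x} = k" if "x \<in> lcosets C" for x
    using card_fibre[OF subgroups(3) _ that, of 3] assms(3) by (simp add: circ_def)
qed

end


section \<open>Heisenberg coordinates of words\<close>

lemma (in group) int_pow_conj:
  assumes "g \<in> carrier G" "x \<in> carrier G"
  shows "inv g \<otimes> x [^] (i::int) \<otimes> g = (inv g \<otimes> x \<otimes> g) [^] i"
proof (rule hom_int_pow)
  have "g \<otimes> (inv g \<otimes> z) = z" if "z \<in> carrier G" for z
    using assms(1) that by (simp add: m_assoc[symmetric])
  then show "(\<lambda>x. inv g \<otimes> x \<otimes> g) \<in> hom G G"
    using assms(1) by (intro homI) (simp_all add: m_assoc)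
qed (use assms in \<open>simp_all add: group_axioms\<close>)

text \<open>Conjugation by \<open>g\<close> sends \<open>x\<close> to \<open>x \<otimes> d\<close>,
  so \<open>d\<close> is their commutator. Conjugation respects powers, and the power of
  \<open>x \<otimes> d\<close> splits because the two factors commute.\<close>

lemma (in group) int_pow_mult_commutator:
  assumes "g \<in> carrier G" "x \<in> carrier G" "d \<in> carrier G" "x \<otimes> d = d \<otimes> x"
    and "x \<otimes> g = g \<otimes> (x \<otimes> d)"
  shows "x [^] (i::int) \<otimes> g = g \<otimes> (x [^] i \<otimes> d [^] i)"
proof -
  have "x \<otimes> d = inv g \<otimes> (x \<otimes> g)"
    using assms by (simp add: inv_solve_left)
  then have "inv g \<otimes> (x [^] i \<otimes> g) = (x \<otimes> d) [^] i"
    using int_pow_conj[of g x i] assms by (simp add: m_assoc)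
  also have "\<dots> = x [^] i \<otimes> d [^] i"
    by (rule int_pow_mult_distrib[OF assms(4,2,3)])
  finally have "x [^] i \<otimes> d [^] i = inv g \<otimes> (x [^] i \<otimes> g)"
    by simp
  then show ?thesis
    using assms by (simp add: inv_solve_left)
qed

lemma (in group) int_pow_commute:
  assumes "x \<in> carrier G" "y \<in> carrier G" "x \<otimes> y = y \<otimes> x"
  shows "x [^] (i::int) \<otimes> y = y \<otimes> x [^] i"
  using int_pow_mult_commutator[of y x \<one> i] assms by simp

lemma (in group) int_pow_mod:
  assumes "x \<in> carrier G" "x [^] n = \<one>"
  shows "x [^] (i mod int n) = x [^] i"
proof -
  have "x [^] (int n * (i div int n)) = \<one>"
    using assms by (simp flip: int_pow_pow add: int_pow_int)
  moreover have "x [^] i = x [^] (int n * (i div int n) + i mod int n)"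
    by simp
  ultimately show ?thesis
    using assms(1) by (simp only: int_pow_mult) simp
qed

text \<open>As \<open>c\<close> commutes with \<open>a\<close> and \<open>b\<close>, sorting a new
  letter into place costs something only when \<open>b\<close> or \<open>inv b\<close> passes
  \<open>a [^] x\<close>, which releases \<open>c [^] x\<close> or its inverse.\<close>

lemma (in group) heis_normal_form_mult:
  fixes x y z :: int
  assumes [simp]: "a \<in> carrier G" "b \<in> carrier G" "c \<in> carrier G"
    and rel: "a \<otimes> b = b \<otimes> a \<otimes> c" "c \<otimes> a = a \<otimes> c" "c \<otimes> b = b \<otimes> c"
  shows "b [^] y \<otimes> a [^] x \<otimes> c [^] z \<otimes> a = b [^] y \<otimes> a [^] (x + 1) \<otimes> c [^] z" (is ?a)
    and "b [^] y \<otimes> a [^] x \<otimes> c [^] z \<otimes> inv a = b [^] y \<otimes> a [^] (x - 1) \<otimes> c [^] z" (is ?a')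
    and "b [^] y \<otimes> a [^] x \<otimes> c [^] z \<otimes> b = b [^] (y + 1) \<otimes> a [^] x \<otimes> c [^] (z + x)" (is ?b)
    and "b [^] y \<otimes> a [^] x \<otimes> c [^] z \<otimes> inv b = b [^] (y - 1) \<otimes> a [^] x \<otimes> c [^] (z - x)" (is ?b')
    and "b [^] y \<otimes> a [^] x \<otimes> c [^] z \<otimes> c = b [^] y \<otimes> a [^] x \<otimes> c [^] (z + 1)" (is ?c)
    and "b [^] y \<otimes> a [^] x \<otimes> c [^] z \<otimes> inv c = b [^] y \<otimes> a [^] x \<otimes> c [^] (z - 1)" (is ?c')
proof -
  have ac: "a [^] (i::int) \<otimes> c = c \<otimes> a [^] i" and bc: "b [^] i \<otimes> c = c \<otimes> b [^] i" for i
    using rel by (simp_all add: int_pow_commute)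
  have "inv a \<otimes> c = c \<otimes> inv a" "inv b \<otimes> c = c \<otimes> inv b"
    using ac[of "-1"] bc[of "-1"] by (simp_all add: int_pow_neg)
  then have c_pow: "c [^] i \<otimes> a = a \<otimes> c [^] i" "c [^] i \<otimes> b = b \<otimes> c [^] i"
    "c [^] i \<otimes> inv a = inv a \<otimes> c [^] i" "c [^] i \<otimes> inv b = inv b \<otimes> c [^] i" for i :: int
    using rel by (simp_all add: int_pow_commute)
  have ab: "a [^] x \<otimes> b = b \<otimes> (a [^] x \<otimes> c [^] x)" for x :: int
    using rel by (intro int_pow_mult_commutator) (simp_all add: m_assoc)
  \<comment> \<open>For \<open>inv b\<close> the commutator is \<open>inv c\<close>: the relation
    gives \<open>b \<otimes> a = a \<otimes> b \<otimes> inv c\<close>, which is then multiplied by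
    \<open>inv b\<close> on both sides.\<close>
  have ab': "a [^] x \<otimes> inv b = inv b \<otimes> (a [^] x \<otimes> c [^] (-x))" for x :: int
  proof -
    have "a [^] x \<otimes> inv b = inv b \<otimes> (a [^] x \<otimes> inv c [^] x)"
    proof (rule int_pow_mult_commutator)
      show "a \<otimes> inv c = inv c \<otimes> a"
        using c_pow(1)[of "-1"] by (simp add: int_pow_neg)
      have "b \<otimes> a = a \<otimes> b \<otimes> inv c"
        unfolding rel(1) by (simp add: m_assoc)
      also have "\<dots> = a \<otimes> inv c \<otimes> b"
        using c_pow(2)[of "-1"] by (simp add: int_pow_neg m_assoc)
      finally have "b \<otimes> a \<otimes> inv b = a \<otimes> inv c"
        by (simp add: m_assoc)
      then show "a \<otimes> inv b = inv b \<otimes> (a \<otimes> inv c)"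
        by (simp add: inv_solve_left m_assoc)
    qed simp_all
    then show ?thesis
      by (simp add: int_pow_inv int_pow_neg)
  qed
  have succ: "d [^] (i + 1) = d [^] i \<otimes> d" "d [^] (i - 1) = d [^] i \<otimes> inv d"
    if "d \<in> carrier G" for d and i :: int
    using that by (simp_all add: int_pow_mult int_pow_diff)
  show ?a ?a' ?c ?c'
    by (simp_all add: succ m_assoc c_pow)
  have "c [^] (z + x) = c [^] x \<otimes> c [^] z" "c [^] (z - x) = c [^] (- x) \<otimes> c [^] z"
    by (simp_all flip: int_pow_mult add: add.commute)
  moreover have "a [^] x \<otimes> (b \<otimes> c [^] z) = b \<otimes> (a [^] x \<otimes> (c [^] x \<otimes> c [^] z))"
    "a [^] x \<otimes> (inv b \<otimes> c [^] z) = inv b \<otimes> (a [^] x \<otimes> (c [^] (- x) \<otimes> c [^] z))"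
    using ab[of x] ab'[of x] by (simp_all add: m_assoc[symmetric])
  ultimately show ?b ?b'
    by (simp_all add: succ m_assoc c_pow)
qed

section \<open>The integer Heisenberg group and reduction modulo \<open>n\<close>\<close>

text \<open>The triple \<open>(x, y, z)\<close> is the upper unitriangular integer matrix with
  \<open>x\<close>, \<open>y\<close> next to the diagonal and \<open>z\<close> in the corner. It
  also stands for \<open>b^y a^x c^z\<close>; the term \<open>x * y'\<close> counts the factors
  \<open>c\<close> released when \<open>a^x\<close> passes the next power of
  \<open>b\<close>.\<close>

fun heis_mult :: "int \<times> int \<times> int \<Rightarrow> int \<times> int \<times> int \<Rightarrow> int \<times> int \<times> int" where
  "heis_mult (x, y, z) (x', y', z') = (x + x', y + y', z + z' + x * y')"

fun heis_letter :: "abc \<times> bool \<Rightarrow> int \<times> int \<times> int" where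
  "heis_letter (Gen_a, s) = (if s then 1 else -1, 0, 0)"
| "heis_letter (Gen_b, s) = (0, if s then 1 else -1, 0)"
| "heis_letter (Gen_c, s) = (0, 0, if s then 1 else -1)"

primrec heis :: "abc word \<Rightarrow> int \<times> int \<times> int" where
  "heis [] = (0, 0, 0)"
| "heis (l # w) = heis_mult (heis_letter l) (heis w)"

fun heis_mod :: "nat \<Rightarrow> int \<times> int \<times> int \<Rightarrow> int \<times> int \<times> int" where
  "heis_mod n (x, y, z) = (x mod int n, y mod int n, z mod int n)"

lemma heis_mult_assoc: "heis_mult (heis_mult t u) v = heis_mult t (heis_mult u v)"
  by (cases t; cases u; cases v) (simp add: algebra_simps)

lemma heis_append: "heis (u @ v) = heis_mult (heis u) (heis v)"
proof (induction u)
  case Nil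
  then show ?case by (cases "heis v") simp
qed (simp add: heis_mult_assoc)

text \<open>The coordinates of a product are integer polynomials in those of the factors.\<close>

lemma heis_mod_mult:
  "heis_mod n (heis_mult (heis_mod n t) (heis_mod n u)) = heis_mod n (heis_mult t u)"
proof (cases t; cases u)
  fix x y z x' y' z'
  assume "t = (x, y, z)" "u = (x', y', z')"
  moreover have "(z mod int n + z' mod int n + x mod int n * (y' mod int n)) mod int n
      = (z + z' + x * y') mod int n"
    by (intro mod_add_cong mod_mult_cong) simp_all
  ultimately show ?thesis
    by (simp add: mod_add_eq)
qed

lemma heis_mod_mult_cong:
  "heis_mod n t = heis_mod n t' \<Longrightarrow> heis_mod n u = heis_mod n u' \<Longrightarrow>
    heis_mod n (heis_mult t u) = heis_mod n (heis_mult t' u')"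
  using heis_mod_mult[of n t u] heis_mod_mult[of n t' u'] by simp

lemma heis_replicate:
  "heis (replicate k (Gen_a, True)) = (int k, 0, 0)"
  "heis (replicate k (Gen_b, True)) = (0, int k, 0)"
  "heis (replicate k (Gen_c, True)) = (0, 0, int k)"
  by (induction k) auto

text \<open>Reduced coordinates are the invariant that tells words apart. Besides congruence and
  cancellation only the relations matter: \<open>ab\<close> and \<open>bac\<close> both have
  coordinates \<open>(1, 1, 1)\<close>, \<open>c\<close> commutes, and the \<open>n\<close>-th
  powers vanish modulo \<open>n\<close>.\<close>

lemma heis_mod_if_word_eq:
  "word_eq (abc_relations n) u v \<Longrightarrow> heis_mod n (heis u) = heis_mod n (heis v)"
proof (induction rule: word_eq.induct)
  case (append u u' v v')
  then show ?case
    unfolding heis_append by (intro heis_mod_mult_cong)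
next
  case (cancel x s)
  then show ?case
    by (cases x; cases s) simp_all
next
  case (relation u v)
  then show ?case
    by (auto simp: abc_relations_def Let_def heis_replicate)
qed simp_all

section \<open>The presented group and its normal form\<close>

interpretation abc: group "abc_group n" for n
  unfolding abc_group_def by (rule group_presented_group)

abbreviation abc_class :: "nat \<Rightarrow> abc word \<Rightarrow> abc word set" where
  "abc_class n \<equiv> word_class (abc_relations n)"

lemma carrier_abc_group: "carrier (abc_group n) = range (abc_class n)"
  by (simp add: abc_group_def presented_group_def)

lemma abc_class_closed [simp]: "abc_class n u \<in> carrier (abc_group n)"
  by (simp add: carrier_abc_group)

lemma abc_class_mult: "abc_class n u \<otimes>\<^bsub>abc_group n\<^esub> abc_class n v = abc_class n (u @ v)"
  by (simp add: abc_group_def presented_group_mult)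

lemma abc_class_Nil: "abc_class n [] = \<one>\<^bsub>abc_group n\<^esub>"
  by (simp add: abc_group_def presented_group_def)

lemma abc_class_inv: "inv\<^bsub>abc_group n\<^esub> abc_class n [(x, True)] = abc_class n [(x, False)]"
proof (rule abc.inv_equality)
  show "abc_class n [(x, False)] \<otimes>\<^bsub>abc_group n\<^esub> abc_class n [(x, True)] = \<one>\<^bsub>abc_group n\<^esub>"
    using word_eq.cancel[of "abc_relations n" x False]
    by (simp add: abc_class_mult flip: abc_class_Nil word_class_eq_iff)
qed simp_all

lemma abc_class_pow:
  "abc_class n u [^]\<^bsub>abc_group n\<^esub> (k::nat) = abc_class n (concat (replicate k u))"
proof (induction k)
  case (Suc k)
  have "concat (replicate k u) @ u = u @ concat (replicate k u)"
    by (induction k) auto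
  then show ?case
    using Suc by (simp add: abc_class_mult)
qed (simp add: abc_class_Nil)

text \<open>With \<open>b\<close> in front the element has coordinates exactly
  \<open>(x, y, z)\<close>; the order \<open>a\<close>, \<open>b\<close>, \<open>c\<close> would add
  \<open>x * y\<close> to the last one.\<close>

definition normal_form :: "nat \<Rightarrow> int \<times> int \<times> int \<Rightarrow> abc word set" where
  "normal_form n = (\<lambda>(x, y, z).
     abc_class n [(Gen_b, True)] [^]\<^bsub>abc_group n\<^esub> y
     \<otimes>\<^bsub>abc_group n\<^esub> abc_class n [(Gen_a, True)] [^]\<^bsub>abc_group n\<^esub> x
     \<otimes>\<^bsub>abc_group n\<^esub> abc_class n [(Gen_c, True)] [^]\<^bsub>abc_group n\<^esub> z)"

lemma normal_form_mult_letter: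
  "normal_form n t \<otimes>\<^bsub>abc_group n\<^esub> abc_class n [l] = normal_form n (heis_mult t (heis_letter l))"
proof -
  have rel: "abc_class n [(Gen_a, True)] \<otimes>\<^bsub>abc_group n\<^esub> abc_class n [(Gen_b, True)]
      = abc_class n [(Gen_b, True)] \<otimes>\<^bsub>abc_group n\<^esub> abc_class n [(Gen_a, True)]
        \<otimes>\<^bsub>abc_group n\<^esub> abc_class n [(Gen_c, True)]"
    "abc_class n [(Gen_c, True)] \<otimes>\<^bsub>abc_group n\<^esub> abc_class n [(Gen_a, True)]
      = abc_class n [(Gen_a, True)] \<otimes>\<^bsub>abc_group n\<^esub> abc_class n [(Gen_c, True)]"
    "abc_class n [(Gen_c, True)] \<otimes>\<^bsub>abc_group n\<^esub> abc_class n [(Gen_b, True)]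
      = abc_class n [(Gen_b, True)] \<otimes>\<^bsub>abc_group n\<^esub> abc_class n [(Gen_c, True)]"
    unfolding abc_class_mult word_class_eq_iff
    by (auto intro!: word_eq.relation simp: abc_relations_def Let_def)
  obtain x y z g s where "t = (x, y, z)" "l = (g, s)"
    by (metis prod_cases3 surj_pair)
  then show ?thesis
    using abc.heis_normal_form_mult[OF abc_class_closed abc_class_closed abc_class_closed rel, of y x z]
    by (cases g; cases s) (simp_all add: normal_form_def abc_class_inv)
qed

lemma abc_class_eq_normal_form: "abc_class n u = normal_form n (heis u)"
\<comment> \<open>Letters are split off at the right end, since normal forms absorb them by right
  multiplication.\<close>
proof (induction u rule: rev_induct)
  case Nil
  then show ?case
    by (simp add: normal_form_def abc_class_Nil)
next
  case (snoc l u)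
  have "heis [l] = heis_letter l"
    by (cases "heis_letter l") simp
  then show ?case
    using snoc by (simp add: heis_append normal_form_mult_letter flip: abc_class_mult)
qed

text \<open>Words of \<open>n\<close> equal generators are trivial by the relations, so exponents
  matter only modulo \<open>n\<close>.\<close>

lemma normal_form_heis_mod: "normal_form n (heis_mod n t) = normal_form n t"
proof -
  have "word_eq (abc_relations n) (replicate n (g, True)) []" for g
    by (cases g) (auto intro!: word_eq.relation simp: abc_relations_def Let_def)
  moreover have "concat (replicate n [l]) = replicate n l" for l :: "abc \<times> bool"
    by (induction n) auto
  ultimately have "abc_class n [(g, True)] [^]\<^bsub>abc_group n\<^esub> n = \<one>\<^bsub>abc_group n\<^esub>" for g
    by (simp add: abc_class_pow word_class_eq_iff flip: abc_class_Nil)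
  then show ?thesis
    by (cases t) (simp add: normal_form_def abc.int_pow_mod)
qed

text \<open>One direction is the invariant. For the other, a class equals the normal form of its
  coordinates, which depends only on their residues. Equality in the group thus becomes arithmetic
  modulo \<open>n\<close>.\<close>

theorem abc_class_eq_iff:
  "abc_class n u = abc_class n v \<longleftrightarrow> heis_mod n (heis u) = heis_mod n (heis v)"
proof
  show "abc_class n u = abc_class n v \<Longrightarrow> heis_mod n (heis u) = heis_mod n (heis v)"
    by (simp add: word_class_eq_iff heis_mod_if_word_eq)
next
  assume "heis_mod n (heis u) = heis_mod n (heis v)"
  then show "abc_class n u = abc_class n v"
    using normal_form_heis_mod[of n "heis u"] normal_form_heis_mod[of n "heis v"]
    by (simp add: abc_class_eq_normal_form)
qed

lemma range_heis_mod_heis: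
  assumes "n > 0"
  shows "range (\<lambda>u. heis_mod n (heis u)) = {0..<int n} \<times> {0..<int n} \<times> {0..<int n}"
proof (intro equalityI subsetI)
  fix t
  assume "t \<in> {0..<int n} \<times> {0..<int n} \<times> {0..<int n}"
  then obtain x y z where t: "t = (x, y, z)" "0 \<le> x" "x < int n" "0 \<le> y" "y < int n"
    "0 \<le> z" "z < int n"
    by auto
  \<comment> \<open>Putting \<open>b\<close> first avoids any mixed term in the last
    coordinate.\<close>
  define u where "u = replicate (nat y) (Gen_b, True) @ replicate (nat x) (Gen_a, True)
    @ replicate (nat z) (Gen_c, True)"
  have "heis_mod n (heis u) = t"
    using t by (simp add: u_def heis_append heis_replicate)
  then show "t \<in> range (\<lambda>u. heis_mod n (heis u))"
    by blast
next
  fix t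
  assume "t \<in> range (\<lambda>u. heis_mod n (heis u))"
  then obtain u where "t = heis_mod n (heis u)"
    by blast
  then show "t \<in> {0..<int n} \<times> {0..<int n} \<times> {0..<int n}"
    using assms by (cases "heis u") simp
qed

section \<open>Order, non-commutativity and generators of the group\<close>

lemma order_abc_group:
  assumes "n > 0"
  shows "order (abc_group n) = n ^ 3"
proof -
  \<comment> \<open>\<open>f\<close> takes the coordinates of a chosen representative; by
    \<open>abc_class_eq_iff\<close> the choice does not matter, and \<open>f\<close> is
    injective.\<close>
  define f where "f D = heis_mod n (heis (inv_into UNIV (abc_class n) D))" for D
  have f: "f (abc_class n u) = heis_mod n (heis u)" for u
    unfolding f_def abc_class_eq_iff[symmetric] by (simp add: f_inv_into_f)
  then have "inj_on f (range (abc_class n))"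
    by (intro inj_onI, elim rangeE) (simp add: abc_class_eq_iff)
  moreover have "f ` range (abc_class n) = {0..<int n} \<times> {0..<int n} \<times> {0..<int n}"
    using f by (simp add: image_image range_heis_mod_heis[OF assms])
  ultimately have "card (range (abc_class n)) = card ({0..<int n} \<times> {0..<int n} \<times> {0..<int n})"
    using card_image by metis
  then show ?thesis
    by (simp add: order_def carrier_abc_group card_cartesian_product power3_eq_cube)
qed

lemma not_comm_abc_group:
  assumes "n > 1"
  shows "\<not> comm_group (abc_group n)"
proof
  assume "comm_group (abc_group n)"
  then have "abc_class n [(Gen_a, True)] \<otimes>\<^bsub>abc_group n\<^esub> abc_class n [(Gen_b, True)] =
      abc_class n [(Gen_b, True)] \<otimes>\<^bsub>abc_group n\<^esub> abc_class n [(Gen_a, True)]"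
    by (intro comm_monoid.m_comm) (simp_all add: comm_group_def)
  then show False
    using assms by (simp add: abc_class_mult abc_class_eq_iff)
qed

lemma generate_abc_group:
  "generate (abc_group n) {abc_class n [(Gen_a, True)], abc_class n [(Gen_b, True)]}
    = carrier (abc_group n)" (is "?H = _")
proof
  show "?H \<subseteq> carrier (abc_group n)"
    by (rule abc.generate_incl) simp
  have mult: "abc_class n (u @ v) \<in> ?H" if "abc_class n u \<in> ?H" "abc_class n v \<in> ?H" for u v
    using generate.eng[OF that] by (simp add: abc_class_mult)
  have ab: "abc_class n [(g, s)] \<in> ?H" if "g \<noteq> Gen_c" for g s
  proof -
    have "abc_class n [(g, True)] \<in> {abc_class n [(Gen_a, True)], abc_class n [(Gen_b, True)]}"
      using that by (cases g) auto
    then show ?thesis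
      using generate.incl[of "abc_class n [(g, True)]"] generate.inv[of "abc_class n [(g, True)]" _ "abc_group n"]
      by (cases s) (simp_all only: abc_class_inv)
  qed
  \<comment> \<open>The commutator of \<open>a\<close> and \<open>b\<close> recovers
    \<open>c\<close>, the commutator in reverse order recovers its inverse. With a word for either
    sign, the induction over words treats all letters alike.\<close>
  have "abc_class n ([(Gen_a, False)] @ [(Gen_b, False)] @ [(Gen_a, True)] @ [(Gen_b, True)]) \<in> ?H"
    "abc_class n ([(Gen_b, False)] @ [(Gen_a, False)] @ [(Gen_b, True)] @ [(Gen_a, True)]) \<in> ?H"
    by (intro mult ab; simp)+
  moreover have
    "abc_class n [(Gen_a, False), (Gen_b, False), (Gen_a, True), (Gen_b, True)] = abc_class n [(Gen_c, True)]"
    "abc_class n [(Gen_b, False), (Gen_a, False), (Gen_b, True), (Gen_a, True)] = abc_class n [(Gen_c, False)]"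
    by (simp_all add: abc_class_eq_iff)
  ultimately have c: "abc_class n [(Gen_c, s)] \<in> ?H" for s
    by (cases s) simp_all
  have "abc_class n u \<in> ?H" for u
  proof (induction u)
    case Nil
    then show ?case
      by (simp add: abc_class_Nil generate.one)
  next
    case (Cons l u)
    obtain g s where "l = (g, s)"
      by (cases l)
    then have "abc_class n [l] \<in> ?H"
      using ab c by (cases g) auto
    then show ?case
      using mult[of "[l]" u] Cons by simp
  qed
  then show "carrier (abc_group n) \<subseteq> ?H"
    by (auto simp: carrier_abc_group)
qed

section \<open>Powers of the three generators and their cyclic subgroups\<close>

lemma heis_concat_replicate_inv:
  "\<exists>z. 2 * z = int k * (int k - 1) \<and>
    heis (concat (replicate k [(Gen_b, False), (Gen_a, False)])) = (- int k, - int k, z)"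
proof (induction k)
  case (Suc k)
  then obtain z where "2 * z = int k * (int k - 1)"
    "heis (concat (replicate k [(Gen_b, False), (Gen_a, False)])) = (- int k, - int k, z)"
    by blast
  \<comment> \<open>Prepending a factor with coordinates \<open>(-1, -1, 0)\<close> adds the product
    of \<open>-1\<close> and \<open>- k\<close> to the last coordinate, so it grows as
    \<open>0 + 1 + ... + (k - 1)\<close>; doubling it avoids a division.\<close>
  then show ?case
    by (intro exI[of _ "z + int k"]) (simp add: algebra_simps)
qed simp

text \<open>
  The third coordinate of \<open>(b\<inverse> a\<inverse>)\<^sup>k\<close> is \<open>k (k - 1) / 2\<close>, hence the restriction to odd \<open>n\<close>.
\<close>

lemma abc_class_pow_eq_one_iff:
  "abc_class n [(Gen_a, True)] [^]\<^bsub>abc_group n\<^esub> k = \<one>\<^bsub>abc_group n\<^esub> \<longleftrightarrow> n dvd k"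
  "abc_class n [(Gen_b, True)] [^]\<^bsub>abc_group n\<^esub> k = \<one>\<^bsub>abc_group n\<^esub> \<longleftrightarrow> n dvd k"
  "odd n \<Longrightarrow> abc_class n [(Gen_b, False), (Gen_a, False)] [^]\<^bsub>abc_group n\<^esub> k = \<one>\<^bsub>abc_group n\<^esub>
    \<longleftrightarrow> n dvd k"
proof -
  assume "odd n"
  obtain z where z: "2 * z = int k * (int k - 1)"
    "heis (concat (replicate k [(Gen_b, False), (Gen_a, False)])) = (- int k, - int k, z)"
    using heis_concat_replicate_inv by blast
  \<comment> \<open>\<open>n\<close> divides \<open>k * (k - 1) = 2 * z\<close>, and
    \<open>2\<close> cancels modulo odd \<open>n\<close>. The converse is read off the coordinate
    \<open>- k\<close>.\<close>
  have "int n dvd z" if "n dvd k"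
  proof -
    have "int n dvd 2 * z"
      using that by (simp add: z(1))
    moreover have "coprime (int n) 2"
      using \<open>odd n\<close> by simp
    ultimately show ?thesis
      by (simp add: coprime_dvd_mult_right_iff)
  qed
  then show "abc_class n [(Gen_b, False), (Gen_a, False)] [^]\<^bsub>abc_group n\<^esub> k = \<one>\<^bsub>abc_group n\<^esub>
    \<longleftrightarrow> n dvd k"
    by (auto simp: abc_class_pow abc_class_eq_iff z(2) mod_eq_0_iff_dvd simp flip: abc_class_Nil)
qed (auto simp: abc_class_pow abc_class_eq_iff heis_replicate mod_eq_0_iff_dvd
      simp flip: abc_class_Nil)

text \<open>The first two coordinates are \<open>(i, 0)\<close> for powers of \<open>a\<close>,
  \<open>(0, i)\<close> for powers of \<open>b\<close> and \<open>(- j, - j)\<close> for powers of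
  the product. In the last two claims the zero forces \<open>n dvd j\<close>, and then the other
  coordinate forces \<open>n dvd i\<close>.\<close>

lemma dvd_if_abc_class_pow_eq:
  fixes i j :: nat
  shows "abc_class n [(Gen_a, True)] [^]\<^bsub>abc_group n\<^esub> i = abc_class n [(Gen_b, True)] [^]\<^bsub>abc_group n\<^esub> j
    \<Longrightarrow> n dvd i"
  and "abc_class n [(Gen_a, True)] [^]\<^bsub>abc_group n\<^esub> i
      = abc_class n [(Gen_b, False), (Gen_a, False)] [^]\<^bsub>abc_group n\<^esub> j \<Longrightarrow> n dvd i"
  and "abc_class n [(Gen_b, True)] [^]\<^bsub>abc_group n\<^esub> i
      = abc_class n [(Gen_b, False), (Gen_a, False)] [^]\<^bsub>abc_group n\<^esub> j \<Longrightarrow> n dvd i"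
proof -
  obtain z where z: "heis (concat (replicate j [(Gen_b, False), (Gen_a, False)])) = (- int j, - int j, z)"
    using heis_concat_replicate_inv by blast
  show "abc_class n [(Gen_a, True)] [^]\<^bsub>abc_group n\<^esub> i
      = abc_class n [(Gen_b, False), (Gen_a, False)] [^]\<^bsub>abc_group n\<^esub> j \<Longrightarrow> n dvd i"
    "abc_class n [(Gen_b, True)] [^]\<^bsub>abc_group n\<^esub> i
      = abc_class n [(Gen_b, False), (Gen_a, False)] [^]\<^bsub>abc_group n\<^esub> j \<Longrightarrow> n dvd i"
    by (auto simp: abc_class_pow abc_class_eq_iff heis_replicate z simp flip: mod_eq_0_iff_dvd of_nat_mod)
qed (auto simp: abc_class_pow abc_class_eq_iff heis_replicate simp flip: mod_eq_0_iff_dvd of_nat_mod)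

text \<open>In a finite group a cyclic subgroup consists of the natural powers of its generator, so
  no negative exponents have to be compared.\<close>

lemma (in group) generate_Int_eq_one:
  assumes "finite (carrier G)" "x \<in> carrier G" "y \<in> carrier G"
    and "\<And>(i::nat) (j::nat). x [^] i = y [^] j \<Longrightarrow> x [^] i = \<one>"
  shows "generate G {x} \<inter> generate G {y} = {\<one>}"
proof
  show "generate G {x} \<inter> generate G {y} \<subseteq> {\<one>}"
  proof
    fix g
    assume "g \<in> generate G {x} \<inter> generate G {y}"
    then have "g \<in> {x [^] k |k. k \<in> (UNIV :: nat set)}" "g \<in> {y [^] k |k. k \<in> (UNIV :: nat set)}"
      using generate_pow_on_finite_carrier assms(1-3) by blast+
    then obtain i j :: nat where "g = x [^] i" "g = y [^] j"
      by blast
    then show "g \<in> {\<one>}"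
      using assms(4)[of i j] by simp
  qed
qed (simp add: generate.one)

lemma (in group) ord_eqI:
  assumes "x \<in> carrier G" "\<And>k::nat. x [^] k = \<one> \<longleftrightarrow> n dvd k"
  shows "ord x = n"
  using assms pow_eq_id[OF assms(1)] by (metis dvd_antisym dvd_refl)

theorem separated_triple_abc_group:
  assumes "n > 1" "odd n"
  defines "\<alpha> \<equiv> abc_class n [(Gen_a, True)]" and "\<beta> \<equiv> abc_class n [(Gen_b, True)]"
    and "\<gamma> \<equiv> abc_class n [(Gen_b, False), (Gen_a, False)]"
  shows "separated_triple (abc_group n) \<alpha> \<beta> \<gamma>
      (generate (abc_group n) {\<alpha>}) (generate (abc_group n) {\<beta>}) (generate (abc_group n) {\<gamma>})"
    and "card (generate (abc_group n) {\<alpha>}) = n" "card (generate (abc_group n) {\<beta>}) = n"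
      "card (generate (abc_group n) {\<gamma>}) = n"
proof -
  have fin: "finite (carrier (abc_group n))"
    using order_abc_group[of n] assms(1) by (intro card_ge_0_finite) (simp add: order_def)
  have closed: "\<alpha> \<in> carrier (abc_group n)" "\<beta> \<in> carrier (abc_group n)" "\<gamma> \<in> carrier (abc_group n)"
    by (simp_all add: \<alpha>_def \<beta>_def \<gamma>_def)
  have pow: "\<alpha> [^]\<^bsub>abc_group n\<^esub> k = \<one>\<^bsub>abc_group n\<^esub> \<longleftrightarrow> n dvd k"
    "\<beta> [^]\<^bsub>abc_group n\<^esub> k = \<one>\<^bsub>abc_group n\<^esub> \<longleftrightarrow> n dvd k"
    "\<gamma> [^]\<^bsub>abc_group n\<^esub> k = \<one>\<^bsub>abc_group n\<^esub> \<longleftrightarrow> n dvd k" for k :: nat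
    unfolding \<alpha>_def \<beta>_def \<gamma>_def using abc_class_pow_eq_one_iff assms(2) by blast+
  show "card (generate (abc_group n) {\<alpha>}) = n" "card (generate (abc_group n) {\<beta>}) = n"
      "card (generate (abc_group n) {\<gamma>}) = n"
    using closed pow by (simp_all flip: abc.generate_pow_card add: abc.ord_eqI)
  show "separated_triple (abc_group n) \<alpha> \<beta> \<gamma>
      (generate (abc_group n) {\<alpha>}) (generate (abc_group n) {\<beta>}) (generate (abc_group n) {\<gamma>})"
  proof unfold_locales
    show "\<alpha> \<otimes>\<^bsub>abc_group n\<^esub> \<beta> \<otimes>\<^bsub>abc_group n\<^esub> \<gamma> = \<one>\<^bsub>abc_group n\<^esub>"
      by (simp add: \<alpha>_def \<beta>_def \<gamma>_def abc_class_mult abc_class_eq_iff flip: abc_class_Nil)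
    show "\<alpha> \<noteq> \<one>\<^bsub>abc_group n\<^esub>" "\<beta> \<noteq> \<one>\<^bsub>abc_group n\<^esub>"
      using pow(1,2)[of 1] closed assms(1) by simp_all
    \<comment> \<open>Powers of two different generators agree only if the exponent is divisible by
      \<open>n\<close>, and then the common value is trivial.\<close>
    show "generate (abc_group n) {\<alpha>} \<inter> generate (abc_group n) {\<beta>} = {\<one>\<^bsub>abc_group n\<^esub>}"
      "generate (abc_group n) {\<alpha>} \<inter> generate (abc_group n) {\<gamma>} = {\<one>\<^bsub>abc_group n\<^esub>}"
      "generate (abc_group n) {\<beta>} \<inter> generate (abc_group n) {\<gamma>} = {\<one>\<^bsub>abc_group n\<^esub>}"
      using dvd_if_abc_class_pow_eq[where n = n, folded \<alpha>_def \<beta>_def \<gamma>_def] pow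
      by (intro abc.generate_Int_eq_one fin closed; blast)+
  qed (simp_all add: fin closed)
qed

section \<open>The bitrade of the group of order \<open>p ^ 3\<close>\<close>

theorem theorem4p4:
  fixes p :: nat
    and G :: "abc word set monoid" (structure)
    and a b \<alpha> \<beta> \<gamma> :: "abc word set"
    and A B C :: "abc word set set"
    and T S :: "(abc word set set \<times> abc word set set \<times> abc word set set) set"
  assumes "Factorial_Ring.prime p" and "odd p"
    and "G = abc_group p"
    and "a = abc_gen p Gen_a" and "b = abc_gen p Gen_b"
    and "\<alpha> = a" and "\<beta> = b" and "\<gamma> = inv b \<otimes> inv a"
    and "A = generate G {\<alpha>}" and "B = generate G {\<beta>}" and "C = generate G {\<gamma>}"
    and "T = {(g <# A, g <# B, g <# C) | g. g \<in> carrier G}"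
    and "S = {(g <# A, g <# B, (g \<otimes> inv \<alpha>) <# C) | g. g \<in> carrier G}"
  shows "group G \<and> \<not> comm_group G \<and> order G = p ^ 3 \<and>
     \<alpha> \<otimes> \<beta> \<otimes> \<gamma> = \<one> \<and>
     A \<inter> B = {\<one>} \<and> A \<inter> C = {\<one>} \<and> B \<inter> C = {\<one>} \<and>
     generate G {\<alpha>, \<beta>, \<gamma>} = carrier G \<and>
     latin_bitrade (lcosets A) (lcosets B) (lcosets C) T S \<and>
     primary_bitrade T S \<and>
     homogeneous_bitrade p (lcosets A) (lcosets B) (lcosets C) T \<and>
     card T = p ^ 3 \<and> card S = p ^ 3"
proof -
  have p: "p > 1"
    using \<open>Factorial_Ring.prime p\<close> by (rule prime_gt_1_nat)
  have \<alpha>: "\<alpha> = abc_class p [(Gen_a, True)]" and \<beta>: "\<beta> = abc_class p [(Gen_b, True)]"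
    using assms(4-7) by (simp_all add: abc_gen_def)
  \<comment> \<open>The product of inverses becomes the class of a two-letter word, the form in
    which its powers were computed.\<close>
  have \<gamma>: "\<gamma> = abc_class p [(Gen_b, False), (Gen_a, False)]"
    using assms(3-8) by (simp add: abc_gen_def abc_class_inv abc_class_mult)
  interpret separated_triple G \<alpha> \<beta> \<gamma> A B C
    using separated_triple_abc_group(1)[OF p \<open>odd p\<close>] assms(3,9-11) by (simp add: \<alpha> \<beta> \<gamma>)
  have card: "card A = p" "card B = p" "card C = p"
    using separated_triple_abc_group(2-4)[OF p \<open>odd p\<close>] assms(3,9-11) by (simp_all add: \<alpha> \<beta> \<gamma>)
  have order: "order G = p ^ 3"
    using p assms(3) by (simp add: order_abc_group)
  have gen: "generate G {\<alpha>, \<beta>} = carrier G"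
    using generate_abc_group[of p] assms(3) by (simp add: \<alpha> \<beta>)
  have "generate G {\<alpha>, \<beta>} \<subseteq> generate G {\<alpha>, \<beta>, \<gamma>}"
    by (rule mono_generate) blast
  then have gen': "generate G {\<alpha>, \<beta>, \<gamma>} = carrier G"
    using gen generate_incl[of "{\<alpha>, \<beta>, \<gamma>}"] by simp
  have T: "T = circ ` carrier G" and S: "S = star ` carrier G"
    unfolding assms(12,13) circ_def star_def by blast+
  \<comment> \<open>Both mates are injective images of the carrier.\<close>
  have "card T = p ^ 3" "card S = p ^ 3"
    using order by (simp_all add: T S card_image circ_inj star_inj order_def)
  moreover have "\<not> comm_group G"
    using not_comm_abc_group[OF p] assms(3) by simp
  ultimately show ?thesis
    unfolding T S
    by (intro conjI group_axioms order prod_eq_one Int_eq gen' latin_bitrade_circ_star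
        primary_bitrade_circ_star[OF gen] homogeneous_circ card)
qed

end
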